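(* Let $\Omega$ be a bounded domain of $\mathbb{R}^N$, let $F\in \mathrm{C}^1(\mathbb{R})$, and let $L:\mathbb{R}\times\mathbb{R}^N\to\mathbb{R}$ be the Lagrangian $L(u,z)=\tfrac12|z|^2+F(u)$. Let $u\in \mathrm{C}^2(\Omega)\cap \mathrm{C}^1(\overline\Omega)$ be a real-valued non-trivial classical solution of Noether's equations $$\sum_{j=1}^N \frac{\partial}{\partial x_j}T_{ij}(x)=0\quad\text{for all } x\in\Omega,\ i=1,\dots,N,$$ where $T_{ij}(x)=\frac{\partial u}{\partial x_i}(x)\frac{\partial u}{\partial x_j}(x)-\delta_{ij}L(u(x),Du(x))$ is the energy-momentum tensor corresponding to $L$. Then $u$ is a solution of the Euler-Lagrange equation $$\Delta u=F'(u)\quad\text{in }\Omega.$$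
   Context: A domain is an open connected subset of $\mathbb{R}^N$. $\mathrm{C}^1(\overline\Omega)$ denotes the set of restrictions to $\Omega$ of continuously differentiable functions on $\mathbb{R}^N$. A function $u$ is called non-trivial if $Du$ is not identically $0$ in $\Omega$, i.e. there is $x_0\in\Omega$ with $Du(x_0)\neq 0$. $\delta_{ij}$ is the Kronecker delta. *)

theory Defs
  imports "HOL-Analysis.Analysis"
begin

text \<open>
  Functions on a domain are represented by total functions on \<open>real ^ 'n\<close>. All notions below are
  local, so on an open set they depend only on the values of the function on that set.
\<close>

definition partial :: "'n::finite \<Rightarrow> (real ^ 'n \<Rightarrow> real) \<Rightarrow> real ^ 'n \<Rightarrow> real" where
  "partial i f x = deriv (\<lambda>t. f (x + t *\<^sub>R axis i 1)) 0"

definition gradient :: "(real ^ 'n::finite \<Rightarrow> real) \<Rightarrow> real ^ 'n \<Rightarrow> real ^ 'n" where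
  "gradient f x = (\<chi> i. partial i f x)"

definition laplacian :: "(real ^ 'n::finite \<Rightarrow> real) \<Rightarrow> real ^ 'n \<Rightarrow> real" where
  "laplacian f x = (\<Sum>i\<in>UNIV. partial i (partial i f) x)"

text \<open>The following two predicates are meant for open \<open>S\<close>.\<close>

definition C1_on :: "(real ^ 'n::finite) set \<Rightarrow> (real ^ 'n \<Rightarrow> real) \<Rightarrow> bool" where
  "C1_on S f \<longleftrightarrow> (\<forall>x\<in>S. f differentiable (at x)) \<and> (\<forall>i. continuous_on S (partial i f))"

definition C2_on :: "(real ^ 'n::finite) set \<Rightarrow> (real ^ 'n \<Rightarrow> real) \<Rightarrow> bool" where
  "C2_on S f \<longleftrightarrow> C1_on S f \<and> (\<forall>i. C1_on S (partial i f))"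

text \<open>\<open>C\<^sup>1\<close> up to the boundary: restrictions to \<open>S\<close> of \<open>C\<^sup>1\<close> functions on the whole space.\<close>

definition C1_closure :: "(real ^ 'n::finite) set \<Rightarrow> (real ^ 'n \<Rightarrow> real) \<Rightarrow> bool" where
  "C1_closure S f \<longleftrightarrow> (\<exists>g. C1_on UNIV g \<and> (\<forall>x\<in>S. f x = g x))"

definition nontrivial_on :: "(real ^ 'n::finite) set \<Rightarrow> (real ^ 'n \<Rightarrow> real) \<Rightarrow> bool" where
  "nontrivial_on S f \<longleftrightarrow> (\<exists>x\<in>S. gradient f x \<noteq> 0)"

definition lagrangian :: "(real \<Rightarrow> real) \<Rightarrow> real \<Rightarrow> real ^ 'n::finite \<Rightarrow> real" where
  "lagrangian F s z = 1/2 * (norm z)\<^sup>2 + F s"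

definition energy_momentum ::
  "(real \<Rightarrow> real) \<Rightarrow> (real ^ 'n::finite \<Rightarrow> real) \<Rightarrow> 'n \<Rightarrow> 'n \<Rightarrow> real ^ 'n \<Rightarrow> real" where
  "energy_momentum F u i j x =
     partial i u x * partial j u x
     - (if i = j then 1 else 0) * lagrangian F (u x) (gradient u x)"

end

theory Submission imports Defs begin

text \<open>
  By symmetry of the second derivatives, the divergence of the energy-momentum tensor is
  \<open>(\<Delta>u - F'(u)) Du\<close>, so the continuous function \<open>h = \<Delta>u - F'(u)\<close> vanishes wherever \<open>Du \<noteq> 0\<close>.
  If \<open>h\<close> took a value \<open>c \<noteq> 0\<close>, then near any point of the level set \<open>{h = c}\<close> we would have
  \<open>Du = 0\<close>, hence \<open>u\<close> and therefore \<open>h\<close> would be constant there. So the level set would be open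
  and closed in \<open>\<Omega>\<close>, hence equal to \<open>\<Omega>\<close>, and \<open>Du\<close> would vanish identically.
\<close>

section \<open>Partial derivatives and the total derivative\<close>

text \<open>\<open>partial\<close> is built from \<open>deriv\<close>, whose value is unspecified
  where no derivative exists. The chain rule along the coordinate line shows that total
  differentiability pins it down.\<close>

lemma partial_eq_derivative_axis:
  fixes f :: "real ^ 'n::finite \<Rightarrow> real"
  assumes "(f has_derivative D) (at x)"
  shows "partial i f x = D (axis i 1)"
proof -
  have f': "(f has_derivative D) (at (x + 0 *\<^sub>R axis i 1))"
    using assms by simp
  have "((\<lambda>t. x + t *\<^sub>R axis i 1) has_derivative (\<lambda>t. t *\<^sub>R axis i 1)) (at (0::real))"
    by (auto intro!: derivative_eq_intros)
  from has_derivative_compose[OF this f']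
  have "((\<lambda>t. f (x + t *\<^sub>R axis i 1)) has_derivative (\<lambda>t. D (t *\<^sub>R axis i 1))) (at 0)" .
  moreover have "(\<lambda>t. D (t *\<^sub>R axis i 1)) = (*) (D (axis i 1))"
    using linear_cmul[OF has_derivative_linear[OF assms]] by (auto simp: mult.commute)
  ultimately have "((\<lambda>t. f (x + t *\<^sub>R axis i 1)) has_real_derivative D (axis i 1)) (at 0)"
    by (simp add: has_field_derivative_def)
  then show ?thesis
    unfolding partial_def by (rule DERIV_imp_deriv)
qed

text \<open>The derivative is needed at every parameter \<open>t\<close> of the line, not only at 0,
  so that the mean value theorem can be applied along segments.\<close>

lemma has_real_derivative_partial:
  fixes f :: "real ^ 'n::finite \<Rightarrow> real"
  assumes "f differentiable (at (a + t *\<^sub>R axis i 1))"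
  shows "((\<lambda>t. f (a + t *\<^sub>R axis i 1)) has_real_derivative partial i f (a + t *\<^sub>R axis i 1)) (at t)"
proof -
  obtain D where D: "(f has_derivative D) (at (a + t *\<^sub>R axis i 1))"
    using assms by (auto simp: differentiable_def)
  have "((\<lambda>t. a + t *\<^sub>R axis i 1) has_derivative (\<lambda>t. t *\<^sub>R axis i 1)) (at t)"
    by (auto intro!: derivative_eq_intros)
  from has_derivative_compose[OF this D]
  have "((\<lambda>t. f (a + t *\<^sub>R axis i 1)) has_derivative (\<lambda>t. D (t *\<^sub>R axis i 1))) (at t)" .
  moreover have "(\<lambda>t. D (t *\<^sub>R axis i 1)) = (*) (D (axis i 1))"
    using linear_cmul[OF has_derivative_linear[OF D]] by (auto simp: mult.commute)
  ultimately show ?thesis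
    by (simp add: has_field_derivative_def partial_eq_derivative_axis[OF D])
qed

lemma has_derivative_zero_if_gradient_zero:
  fixes f :: "real ^ 'n::finite \<Rightarrow> real"
  assumes "f differentiable (at x)" and "gradient f x = 0"
  shows "(f has_derivative (\<lambda>_. 0)) (at x)"
proof -
  obtain D where D: "(f has_derivative D) (at x)"
    using assms(1) by (auto simp: differentiable_def)
  have "D (axis i 1) = 0" for i
    using assms(2) partial_eq_derivative_axis[OF D, of i]
    by (simp add: gradient_def vec_eq_iff)
  then have "D = (\<lambda>_. 0)"
    by (intro linear_eq_stdbasis has_derivative_linear[OF D])
      (auto simp: Basis_vec_def linear_iff)
  with D show ?thesis by simp
qed

lemma partial_locally_constant:
  fixes f :: "real ^ 'n::finite \<Rightarrow> real"
  assumes "open S" "x \<in> S" "\<And>y. y \<in> S \<Longrightarrow> f y = c"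
  shows "partial i f x = 0"
proof -
  have "((\<lambda>_. c) has_derivative (\<lambda>_. 0)) (at x)"
    by simp
  then have "(f has_derivative (\<lambda>_. 0)) (at x)"
    by (rule has_derivative_transform_within_open[OF _ assms(1,2)]) (simp add: assms(3))
  from partial_eq_derivative_axis[OF this] show ?thesis .
qed

section \<open>Symmetry of the second partial derivatives\<close>

lemma C2_on_differentiable:
  assumes "C2_on S f" "x \<in> S"
  shows "f differentiable (at x)" "partial i f differentiable (at x)"
  using assms by (auto simp: C2_on_def C1_on_def)

text \<open>The mean value theorem is applied first in direction \<open>i\<close>, then in direction
  \<open>j\<close>. The second difference over the square is symmetric in \<open>i\<close> and
  \<open>j\<close>, while the mixed derivative on the right is not visibly so; this is what yields
  Schwarz's theorem.\<close>

lemma second_difference_mean_value: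
  fixes f :: "real ^ 'n::finite \<Rightarrow> real"
  assumes C2: "C2_on S f" and h: "0 < h"
    and S: "\<And>s t. 0 \<le> s \<Longrightarrow> s \<le> h \<Longrightarrow> 0 \<le> t \<Longrightarrow> t \<le> h \<Longrightarrow>
      x + s *\<^sub>R axis i 1 + t *\<^sub>R axis j 1 \<in> S"
  obtains s t where "0 < s" "s < h" "0 < t" "t < h"
    "f (x + h *\<^sub>R axis i 1 + h *\<^sub>R axis j 1) - f (x + h *\<^sub>R axis i 1) - f (x + h *\<^sub>R axis j 1) + f x
      = h\<^sup>2 * partial j (partial i f) (x + s *\<^sub>R axis i 1 + t *\<^sub>R axis j 1)"
proof -
  let ?a = "axis i 1 :: real ^ 'n" and ?b = "axis j 1 :: real ^ 'n"
  have di: "((\<lambda>s. f (x + s *\<^sub>R ?a + t *\<^sub>R ?b)) has_real_derivative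
      partial i f (x + s *\<^sub>R ?a + t *\<^sub>R ?b)) (at s)"
    if "0 \<le> s" "s \<le> h" "0 \<le> t" "t \<le> h" for s t
    using has_real_derivative_partial[of f "x + t *\<^sub>R ?b" s i] C2_on_differentiable(1)[OF C2 S[OF that]]
    by (simp add: add.assoc add.commute add.left_commute)
  have dj: "((\<lambda>t. partial i f (x + s *\<^sub>R ?a + t *\<^sub>R ?b)) has_real_derivative
      partial j (partial i f) (x + s *\<^sub>R ?a + t *\<^sub>R ?b)) (at t)"
    if "0 \<le> s" "s \<le> h" "0 \<le> t" "t \<le> h" for s t
    using C2_on_differentiable(2)[OF C2 S[OF that]] by (rule has_real_derivative_partial)
  \<comment> \<open>The difference of \<open>f\<close> between opposite sides of the square; its
    increment over [0, h] is the second difference. The summand \<open>0 *\<^sub>R ?b\<close> is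
    kept so that \<open>di\<close> matches with \<open>t\<close> = 0.\<close>
  let ?\<phi> = "\<lambda>s. f (x + s *\<^sub>R ?a + h *\<^sub>R ?b) - f (x + s *\<^sub>R ?a + 0 *\<^sub>R ?b)"
  have "(?\<phi> has_real_derivative
      partial i f (x + s *\<^sub>R ?a + h *\<^sub>R ?b) - partial i f (x + s *\<^sub>R ?a + 0 *\<^sub>R ?b)) (at s)"
    if "0 \<le> s" "s \<le> h" for s
    using that h by (intro DERIV_diff di) auto
  from MVT2[OF h this]
  obtain s where s: "0 < s" "s < h" and
    1: "?\<phi> h - ?\<phi> 0 = (h - 0) *
      (partial i f (x + s *\<^sub>R ?a + h *\<^sub>R ?b) - partial i f (x + s *\<^sub>R ?a + 0 *\<^sub>R ?b))"
    by blast
  have "\<exists>t>0. t < h \<and> partial i f (x + s *\<^sub>R ?a + h *\<^sub>R ?b) - partial i f (x + s *\<^sub>R ?a + 0 *\<^sub>R ?b)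
      = (h - 0) * partial j (partial i f) (x + s *\<^sub>R ?a + t *\<^sub>R ?b)"
    using s by (intro MVT2 h dj) auto
  then obtain t where t: "0 < t" "t < h" and
    2: "partial i f (x + s *\<^sub>R ?a + h *\<^sub>R ?b) - partial i f (x + s *\<^sub>R ?a + 0 *\<^sub>R ?b)
      = (h - 0) * partial j (partial i f) (x + s *\<^sub>R ?a + t *\<^sub>R ?b)"
    by blast
  show thesis
    using that[OF s t] 1[unfolded 2] by (simp add: power2_eq_square algebra_simps)
qed

text \<open>Schwarz's theorem: on each small square at \<open>x\<close> the two mixed derivatives
  take a common value, though at different points, and both are continuous at
  \<open>x\<close>.\<close>

lemma C2_on_partial_commute:
  fixes f :: "real ^ 'n::finite \<Rightarrow> real"
  assumes C2: "C2_on S f" and "open S" and x: "x \<in> S"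
  shows "partial i (partial j f) x = partial j (partial i f) x"
proof (rule ccontr)
  let ?a = "axis i 1 :: real ^ 'n" and ?b = "axis j 1 :: real ^ 'n"
  let ?P = "partial i (partial j f)" and ?Q = "partial j (partial i f)"
  \<comment> \<open>Half the gap between the two values, so that their open
    \<open>e\<close>-neighbourhoods are disjoint.\<close>
  define e where "e = \<bar>?P x - ?Q x\<bar> / 2"
  assume "?P x \<noteq> ?Q x"
  then have e: "e > 0" by (simp add: e_def)
  have cont: "isCont ?P x" "isCont ?Q x"
    using C2 x unfolding C2_on_def C1_on_def by (simp_all add: continuous_on_eq_continuous_at[OF \<open>open S\<close>])
  obtain d1 where d1: "d1 > 0" "\<And>y. dist y x < d1 \<Longrightarrow> dist (?P y) (?P x) < e"
    using cont(1) e by (auto simp: continuous_at_eps_delta)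
  obtain d2 where d2: "d2 > 0" "\<And>y. dist y x < d2 \<Longrightarrow> dist (?Q y) (?Q x) < e"
    using cont(2) e by (auto simp: continuous_at_eps_delta)
  obtain d3 where d3: "d3 > 0" "\<And>y. dist y x < d3 \<Longrightarrow> y \<in> S"
    using \<open>open S\<close> x by (auto simp: open_dist)
  \<comment> \<open>Points of the square lie within 2h of \<open>x\<close>, hence strictly within
    3h, the smallest of the three radii.\<close>
  define h where "h = min d1 (min d2 d3) / 3"
  have h: "h > 0" using d1 d2 d3 by (simp add: h_def)
  have near: "dist (x + s *\<^sub>R ?a + t *\<^sub>R ?b) x < min d1 (min d2 d3)"
    if "0 \<le> s" "s \<le> h" "0 \<le> t" "t \<le> h" for s t
  proof -
    have "dist (x + s *\<^sub>R ?a + t *\<^sub>R ?b) x = norm (s *\<^sub>R ?a + t *\<^sub>R ?b)"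
      by (simp add: dist_norm add.assoc)
    also have "\<dots> \<le> norm (s *\<^sub>R ?a) + norm (t *\<^sub>R ?b)"
      by (rule norm_triangle_ineq)
    also have "\<dots> = s + t"
      using that by simp
    also have "\<dots> < 3 * h"
      using that h by linarith
    finally show ?thesis by (simp add: h_def)
  qed
  have swap: "x + s *\<^sub>R ?b + t *\<^sub>R ?a = x + t *\<^sub>R ?a + s *\<^sub>R ?b" for s t
    by (simp add: add.assoc add.commute)
  obtain s t where st: "0 < s" "s < h" "0 < t" "t < h" and
    Q: "f (x + h *\<^sub>R ?a + h *\<^sub>R ?b) - f (x + h *\<^sub>R ?a) - f (x + h *\<^sub>R ?b) + f x
      = h\<^sup>2 * ?Q (x + s *\<^sub>R ?a + t *\<^sub>R ?b)"
    using second_difference_mean_value[OF C2 h, of x i j] near d3 by (metis min_less_iff_conj)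
  obtain s' t' where st': "0 < s'" "s' < h" "0 < t'" "t' < h" and
    P: "f (x + h *\<^sub>R ?b + h *\<^sub>R ?a) - f (x + h *\<^sub>R ?b) - f (x + h *\<^sub>R ?a) + f x
      = h\<^sup>2 * ?P (x + s' *\<^sub>R ?b + t' *\<^sub>R ?a)"
    using second_difference_mean_value[OF C2 h, of x j i] near d3 unfolding swap
    by (metis min_less_iff_conj)
  \<comment> \<open>Both sides, multiplied by the nonzero factor \<open>h\<^sup>2\<close>, equal the
    same second difference.\<close>
  have "?P (x + t' *\<^sub>R ?a + s' *\<^sub>R ?b) = ?Q (x + s *\<^sub>R ?a + t *\<^sub>R ?b)"
    using P Q h unfolding swap by (smt (verit) mult_left_cancel zero_less_power)
  moreover have "dist (?P (x + t' *\<^sub>R ?a + s' *\<^sub>R ?b)) (?P x) < e"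
    using near[of t' s'] st' d1 by simp
  moreover have "dist (?Q (x + s *\<^sub>R ?a + t *\<^sub>R ?b)) (?Q x) < e"
    using near[of s t] st d2 by simp
  ultimately show False
    unfolding dist_real_def e_def by argo
qed

section \<open>The divergence identity and the Euler-Lagrange equation\<close>

text \<open>Differentiating the products gives the Laplacian term and a sum of mixed second
  derivatives times first derivatives. The gradient part of the Lagrangian gives the same sum with
  the order of differentiation exchanged, so the two cancel by symmetry.\<close>

lemma energy_momentum_divergence:
  fixes u :: "real ^ 'n::finite \<Rightarrow> real"
  assumes C2: "C2_on S u" and "open S" and x: "x \<in> S"
    and F: "F differentiable (at (u x))"
  shows "(\<Sum>j\<in>UNIV. partial j (energy_momentum F u i j) x)
    = (laplacian u x - deriv F (u x)) * partial i u x"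
proof -
  let ?e = "\<lambda>j. axis j 1 :: real ^ 'n"
  have u': "((\<lambda>t. u (x + t *\<^sub>R ?e j)) has_real_derivative partial j u x) (at 0)" for j
    using has_real_derivative_partial[of u x 0 j] C2_on_differentiable(1)[OF C2 x] by simp
  have u'': "((\<lambda>t. partial k u (x + t *\<^sub>R ?e j)) has_real_derivative partial j (partial k u) x) (at 0)" for j k
    using has_real_derivative_partial[of "partial k u" x 0 j] C2_on_differentiable(2)[OF C2 x] by simp
  have "(F has_real_derivative deriv F (u x)) (at (u x))"
    using F by (simp add: DERIV_deriv_iff_real_differentiable)
  then have Fu: "((\<lambda>t. F (u (x + t *\<^sub>R ?e j))) has_real_derivative deriv F (u x) * partial j u x) (at 0)" for j
    using DERIV_chain2[of F "deriv F (u x)" "\<lambda>t. u (x + t *\<^sub>R ?e j)"] u' by simp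
  \<comment> \<open>The squared norm is written as a sum of squares so that the derivative rules
    apply term by term.\<close>
  have T: "energy_momentum F u i j = (\<lambda>y. partial i u y * partial j u y
      - (if i = j then 1 else 0) * (1/2 * (\<Sum>k\<in>UNIV. (partial k u y)\<^sup>2) + F (u y)))" for j
    unfolding energy_momentum_def lagrangian_def gradient_def norm_vec_def L2_set_def
    by (simp add: sum_nonneg fun_eq_iff)
  have "((\<lambda>t. energy_momentum F u i j (x + t *\<^sub>R ?e j)) has_real_derivative
      partial j (partial i u) x * partial j u x + partial i u x * partial j (partial j u) x
      - (if i = j then 1 else 0) *
        ((\<Sum>k\<in>UNIV. partial k u x * partial j (partial k u) x) + deriv F (u x) * partial j u x)) (at 0)" for j
    unfolding T
    by (rule derivative_eq_intros u' u'' Fu refl)+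
      (auto simp: sum_distrib_left algebra_simps)
  then have "partial j (energy_momentum F u i j) x =
      partial j (partial i u) x * partial j u x + partial i u x * partial j (partial j u) x
      - (if i = j then (\<Sum>k\<in>UNIV. partial k u x * partial j (partial k u) x)
          + deriv F (u x) * partial j u x else 0)" for j
    unfolding partial_def[of j "energy_momentum F u i j"]
    by (subst DERIV_imp_deriv) (assumption, simp)
  \<comment> \<open>Summing over \<open>j\<close>, the Kronecker delta keeps only the Lagrangian
    term with \<open>j\<close> = \<open>i\<close>.\<close>
  then have "(\<Sum>j\<in>UNIV. partial j (energy_momentum F u i j) x) =
      (\<Sum>j\<in>UNIV. partial j (partial i u) x * partial j u x) + partial i u x * laplacian u x
      - ((\<Sum>k\<in>UNIV. partial k u x * partial i (partial k u) x) + deriv F (u x) * partial i u x)"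
    by (simp add: sum.distrib sum_subtractf laplacian_def sum_distrib_left)
  also have "(\<Sum>k\<in>UNIV. partial k u x * partial i (partial k u) x)
      = (\<Sum>j\<in>UNIV. partial j (partial i u) x * partial j u x)"
    using C2_on_partial_commute[OF C2 \<open>open S\<close> x] by (simp add: mult.commute)
  finally show ?thesis by (simp add: algebra_simps)
qed

theorem theorem1:
  fixes \<Omega> :: "(real ^ 'n::finite) set"
    and F :: "real \<Rightarrow> real"
    and u :: "real ^ 'n \<Rightarrow> real"
  assumes "open \<Omega>" and "connected \<Omega>" and "bounded \<Omega>"
    and "F C1_differentiable_on UNIV"
    and "C2_on \<Omega> u" and "C1_closure \<Omega> u"
    and "nontrivial_on \<Omega> u"
    and noether: "\<And>i x. x \<in> \<Omega> \<Longrightarrow> (\<Sum>j\<in>UNIV. partial j (energy_momentum F u i j) x) = 0"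
  shows "\<forall>x\<in>\<Omega>. laplacian u x = deriv F (u x)"
proof (rule ccontr)
  define h where "h x = laplacian u x - deriv F (u x)" for x
  assume "\<not> (\<forall>x\<in>\<Omega>. laplacian u x = deriv F (u x))"
  then obtain x where x: "x \<in> \<Omega>" "h x \<noteq> 0"
    by (auto simp: h_def)
  \<comment> \<open>A continuous derivative of \<open>F\<close> is needed for the continuity of
    \<open>h\<close>.\<close>
  obtain F' where F': "\<And>y. (F has_real_derivative F' y) (at y)" "continuous_on UNIV F'"
    using assms(4) by (auto simp: C1_differentiable_on_def has_real_derivative_iff_has_vector_derivative)
  have deriv_F: "deriv F = F'"
    using F'(1) by (auto intro: DERIV_imp_deriv)
  have gradient_zero: "gradient u y = 0" if "y \<in> \<Omega>" "h y \<noteq> 0" for y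
  proof -
    have "h y * partial i u y = 0" for i
      using energy_momentum_divergence[OF assms(5,1) that(1), of F i] noether[OF that(1)] F'(1)
      by (auto simp: h_def real_differentiable_def)
    with that(2) show ?thesis
      by (simp add: gradient_def vec_eq_iff)
  qed
  have "continuous_on \<Omega> u"
    using C2_on_differentiable(1)[OF assms(5)]
    by (auto intro!: continuous_at_imp_continuous_on differentiable_imp_continuous_within)
  then have cont_h: "continuous_on \<Omega> h"
    unfolding h_def deriv_F laplacian_def
    using assms(5) unfolding C2_on_def C1_on_def
    by (intro continuous_on_diff continuous_on_sum continuous_on_compose2[OF F'(2)]) auto
  let ?A = "{y \<in> \<Omega>. h y = h x}"
  have "closedin (top_of_set \<Omega>) ?A"
    using cont_h by (rule continuous_closedin_preimage_constant)
  moreover have "openin (top_of_set \<Omega>) ?A"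
  proof -
    have "open ?A"
      unfolding open_contains_ball
    proof
      fix y assume y: "y \<in> ?A"
      \<comment> \<open>Since \<open>h y = h x\<close> is nonzero, continuity keeps \<open>h\<close>
        nonzero on a ball around \<open>y\<close>, so \<open>gradient_zero\<close> applies on the
        whole ball and not just at \<open>y\<close>.\<close>
      have "open (\<Omega> \<inter> h -` (- {0}))"
        using continuous_open_preimage[OF cont_h assms(1)] by blast
      then obtain r where r: "r > 0" "ball y r \<subseteq> \<Omega> \<inter> h -` (- {0})"
        using y x unfolding open_contains_ball by force
      have grad: "gradient u z = 0" if "z \<in> ball y r" for z
        using gradient_zero r that by blast
      have "(u has_derivative (\<lambda>_. 0)) (at z within ball y r)" if "z \<in> ball y r" for z
      proof -
        have "z \<in> \<Omega>"
          using r that by blast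
        then show ?thesis
          by (rule has_derivative_at_withinI[OF has_derivative_zero_if_gradient_zero,
                OF C2_on_differentiable(1)[OF assms(5)] grad[OF that]])
      qed
      then have "\<exists>c. \<forall>z\<in>ball y r. u z = c"
        by (rule has_derivative_zero_constant[OF convex_ball])
      then obtain c where c: "\<And>z. z \<in> ball y r \<Longrightarrow> u z = c"
        by blast
      \<comment> \<open>On the ball each \<open>partial i u\<close> is identically 0, so its own
        partial derivatives vanish there too.\<close>
      have "partial i (partial i u) z = 0" if "z \<in> ball y r" for i z
        using grad
        by (intro partial_locally_constant[OF open_ball that]) (simp add: gradient_def vec_eq_iff)
      then have "h z = - deriv F c" if "z \<in> ball y r" for z
        using that c by (simp add: h_def laplacian_def)
      \<comment> \<open>Now \<open>h\<close> is constant on the ball, and its value at the centre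
        \<open>y\<close> is \<open>h x\<close>.\<close>
      then have "ball y r \<subseteq> ?A"
        using r y by (auto dest: subsetD)
      with r(1) show "\<exists>r>0. ball y r \<subseteq> ?A"
        by blast
    qed
    then show ?thesis
      by (simp add: openin_open_eq[OF assms(1)])
  qed
  \<comment> \<open>The other clopen possibility, the empty set, is excluded because
    \<open>x\<close> lies in \<open>?A\<close>.\<close>
  ultimately have "?A = \<Omega>"
    using assms(2) x unfolding connected_clopen by blast
  then have "h y = h x" if "y \<in> \<Omega>" for y
    using that by blast
  then have "gradient u y = 0" if "y \<in> \<Omega>" for y
    using gradient_zero[OF that] x(2) that by simp
  then show False
    using assms(7) by (auto simp: nontrivial_on_def)
qed

end
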